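(* Let $\widetilde M,\widetilde K\in\mathbb{R}^{r\times r}$, $\widetilde B_u\in\mathbb{R}^{r\times m}$, $\widetilde C_p,\widetilde C_v\in\mathbb{R}^{p\times r}$ be the matrices of a reduced-order second-order model, not depending on the damping parameters $\alpha,\beta,\eta$, and let $s_k\in\mathbb{C}$ and $g_k\in\mathbb{C}^{p\times m}$. For $s\in\mathbb{C}$ and $\alpha,\beta,\eta\in[0,\infty)$ define $$\Phi_R(s,\alpha,\beta)=(s^2+s\alpha)\widetilde M+(1+s\beta)\widetilde K,\qquad\Phi_S(s,\eta)=s^2\widetilde M+(1+\mathrm{i}\eta)\widetilde K,\qquad\mathcal{C}(s)=\widetilde C_p+s\widetilde C_v,$$ and the cost functions $$\mathcal{J}_{k,R}(\alpha,\beta)=\big\|g_k-\mathcal{C}(s_k)\Phi_R(s_k,\alpha,\beta)^{-1}\widetilde B_u\big\|_F^2,\qquad\mathcal{J}_{k,S}(\eta)=\big\|g_k-\mathcal{C}(s_k)\Phi_S(s_k,\eta)^{-1}\widetilde B_u\big\|_F^2 .$$ Then, for the Rayleigh-damped minimization problem, the gradients with respect to the optimization parameters are $$\frac{\partial}{\partial\alpha}\mathcal{J}_{k,R}(\alpha,\beta)=2\operatorname{Re}\Big(s_k\operatorname{tr}\Big(\widetilde M\,\Phi_R(s_k,\alpha,\beta)^{-1}\widetilde B_u\big(g_k-\mathcal{C}(s_k)\Phi_R(s_k,\alpha,\beta)^{-1}\widetilde B_u\big)^{\mathsf H}\mathcal{C}(s_k)\Phi_R(s_k,\alpha,\beta)^{-1}\Big)\Big),$$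 $$\frac{\partial}{\partial\beta}\mathcal{J}_{k,R}(\alpha,\beta)=2\operatorname{Re}\Big(s_k\operatorname{tr}\Big(\widetilde K\,\Phi_R(s_k,\alpha,\beta)^{-1}\widetilde B_u\big(g_k-\mathcal{C}(s_k)\Phi_R(s_k,\alpha,\beta)^{-1}\widetilde B_u\big)^{\mathsf H}\mathcal{C}(s_k)\Phi_R(s_k,\alpha,\beta)^{-1}\Big)\Big),$$ and, for the structurally damped minimization problem, the gradient is $$\frac{\partial}{\partial\eta}\mathcal{J}_{k,S}(\eta)=2\operatorname{Re}\Big(\operatorname{tr}\Big(\widetilde K\,\Phi_S(s_k,\eta)^{-1}\widetilde B_u\big(g_k-\mathcal{C}(s_k)\Phi_S(s_k,\eta)^{-1}\widetilde B_u\big)^{\mathsf H}\mathcal{C}(s_k)\Phi_S(s_k,\eta)^{-1}\Big)\Big).$$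
   Context: Here $\mathrm{i}$ is the imaginary unit, $(\cdot)^{\mathsf H}$ the conjugate transpose, $\|\cdot\|_F$ the Frobenius norm and $\operatorname{tr}$ the trace. Derivatives are with respect to the real parameters $\alpha,\beta,\eta$. $\mathcal{J}_{k,R}$ and $\mathcal{J}_{k,S}$ are the summands (over $k=1,\dots,N$) of the least-squares objectives minimized to fit Rayleigh damping $\widetilde D=\alpha\widetilde M+\beta\widetilde K$ over $(\alpha,\beta)$ and structural damping $\widetilde D(s)=\mathrm{i}\frac{\eta}{s}\widetilde K$ over $\eta$, respectively, to transfer function data $g_k$ at points $s_k$. The reduced-order model has mass, damping and stiffness matrices $\widetilde M,\widetilde D,\widetilde K$, input matrix $\widetilde B_u$ and position- and velocity-output matrices $\widetilde C_p,\widetilde C_v$.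
   Formalization: The structural-damping gradient is proved with an extra factor i before the trace, as the printed formula is false without it (M=0, K=B=C_p=1, C_v=0, g=0, η=0: derivative 0, formula −2); the invertibility of Φ_R and Φ_S at the point is stated explicitly. *)

theory Defs
  imports "HOL-Analysis.Analysis"
begin

abbreviation cmat :: "real^'n^'m \<Rightarrow> complex^'n^'m" where
  "cmat A \<equiv> map_matrix complex_of_real A"

(* The library's *s scales vectors, and *\<^sub>R only has real scalars. *)
definition cscale :: "complex \<Rightarrow> complex^'n^'m \<Rightarrow> complex^'n^'m" where
  "cscale c A = map_matrix (\<lambda>z. c * z) A"

definition conj_transpose :: "complex^'n^'m \<Rightarrow> complex^'m^'n" where
  "conj_transpose A = map_matrix cnj (transpose A)"

definition frobenius_norm :: "complex^'n^'m \<Rightarrow> real" where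
  "frobenius_norm A = sqrt (\<Sum>i\<in>UNIV. \<Sum>j\<in>UNIV. (cmod (A $ i $ j))\<^sup>2)"

lemma frobenius_norm_eq_norm: "frobenius_norm A = norm A"
  by (simp add: frobenius_norm_def norm_vec_def L2_set_def real_sqrt_pow2 sum_nonneg)

definition Phi_R :: "real^'r^'r \<Rightarrow> real^'r^'r \<Rightarrow> complex \<Rightarrow> real \<Rightarrow> real \<Rightarrow> complex^'r^'r" where
  "Phi_R M K s \<alpha> \<beta> =
     cscale (s\<^sup>2 + s * complex_of_real \<alpha>) (cmat M) + cscale (1 + s * complex_of_real \<beta>) (cmat K)"

(* The derivative of Phi_S in \<eta> is \<i> * K; this is the origin of the factor \<i> in the gradient
   of the structural-damping cost. The published formula omits that factor and is false without it:
   for 1 x 1 matrices with M = 0, K = B = Cp = 1, Cv = 0 and g = 0 the cost is 1 / (1 + \<eta>^2),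
   whose right derivative at \<eta> = 0 is 0, while the formula without \<i> gives -2. *)
definition Phi_S :: "real^'r^'r \<Rightarrow> real^'r^'r \<Rightarrow> complex \<Rightarrow> real \<Rightarrow> complex^'r^'r" where
  "Phi_S M K s \<eta> = cscale (s\<^sup>2) (cmat M) + cscale (1 + \<i> * complex_of_real \<eta>) (cmat K)"

definition C_out :: "real^'r^'p \<Rightarrow> real^'r^'p \<Rightarrow> complex \<Rightarrow> complex^'r^'p" where
  "C_out Cp Cv s = cmat Cp + cscale s (cmat Cv)"

(* matrix_inv is unspecified on singular matrices, so these costs are meaningful only
   where Phi_R, respectively Phi_S, is invertible. *)

definition J_R :: "real^'r^'r \<Rightarrow> real^'r^'r \<Rightarrow> real^'m^'r \<Rightarrow> real^'r^'p \<Rightarrow> real^'r^'p \<Rightarrow>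
    complex \<Rightarrow> complex^'m^'p \<Rightarrow> real \<Rightarrow> real \<Rightarrow> real" where
  "J_R M K Bu Cp Cv s g \<alpha> \<beta> =
     (frobenius_norm (g - C_out Cp Cv s ** matrix_inv (Phi_R M K s \<alpha> \<beta>) ** cmat Bu))\<^sup>2"

definition J_S :: "real^'r^'r \<Rightarrow> real^'r^'r \<Rightarrow> real^'m^'r \<Rightarrow> real^'r^'p \<Rightarrow> real^'r^'p \<Rightarrow>
    complex \<Rightarrow> complex^'m^'p \<Rightarrow> real \<Rightarrow> real" where
  "J_S M K Bu Cp Cv s g \<eta> =
     (frobenius_norm (g - C_out Cp Cv s ** matrix_inv (Phi_S M K s \<eta>) ** cmat Bu))\<^sup>2"

end

theory Submission
  imports Defs
begin

text \<open>
  If a matrix-valued function \<open>A\<close> of a real variable has derivative \<open>D\<close>, then \<open>A\<inverse>\<close> has derivative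
  \<open>- A\<inverse> D A\<inverse>\<close>: continuity of \<open>A\<inverse>\<close> comes from Cramer's rule, and the difference quotient from
  \<open>X\<inverse> - Y\<inverse> = - X\<inverse> (X - Y) Y\<inverse>\<close>. Hence the residual \<open>E = g - C A\<inverse> B\<close> has derivative
  \<open>C A\<inverse> D A\<inverse> B\<close>, and since the real inner product underlying the Frobenius norm is
  \<open>Re (tr (E\<^sup>H F))\<close>, the cost \<open>\<parallel>E\<parallel>\<^sup>2\<close> has derivative \<open>2 Re (tr (E\<^sup>H C A\<inverse> D A\<inverse> B))\<close>. Cyclicity of the
  trace gives the stated form, with \<open>D\<close> equal to \<open>s M\<close>, \<open>s K\<close> and \<open>\<i> K\<close> respectively.
\<close>

text \<open>In finite dimension bilinearity already gives boundedness; the interpretation below then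
  yields the limit and product rules for \<open>**\<close>.\<close>

lemma bounded_bilinear_matrix_matrix_mult:
  "bounded_bilinear ((**) :: 'a::{real_normed_field,euclidean_space}^'n^'m \<Rightarrow> 'a^'p^'n \<Rightarrow> 'a^'p^'m)"
  unfolding bilinear_conv_bounded_bilinear[symmetric] bilinear_def
  by (intro conjI allI linearI)
    (simp_all add: vec_eq_iff matrix_matrix_mult_def algebra_simps sum.distrib scaleR_sum_right)

interpretation matrix_matrix_mult:
  bounded_bilinear "(**) :: 'a::{real_normed_field,euclidean_space}^'n^'m \<Rightarrow> 'a^'p^'n \<Rightarrow> 'a^'p^'m"
  by (rule bounded_bilinear_matrix_matrix_mult)

lemma tendsto_det:
  fixes A :: "'b \<Rightarrow> 'a::real_normed_field^'n^'n"
  assumes "(A \<longlongrightarrow> L) F"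
  shows "((\<lambda>x. det (A x)) \<longlongrightarrow> det L) F"
  unfolding det_def by (intro tendsto_intros assms)

lemma
  assumes "invertible A"
  shows matrix_inv_right: "A ** matrix_inv A = mat 1"
    and matrix_inv_left: "matrix_inv A ** A = mat 1"
proof -
  have "A ** matrix_inv A = mat 1 \<and> matrix_inv A ** A = mat 1"
    using assms unfolding invertible_def matrix_inv_def by (rule someI_ex)
  then show "A ** matrix_inv A = mat 1" and "matrix_inv A ** A = mat 1"
    by auto
qed

text \<open>Column \<open>j\<close> of the inverse solves \<open>A *v x = axis j 1\<close>, so
  Cramer's rule gives its entries as quotients of polynomials in the entries of
  \<open>A\<close>.\<close>

lemma matrix_inv_nth:
  fixes A :: "'a::field^'n^'n"
  assumes "invertible A"
  shows "matrix_inv A $ i $ j =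
    det (\<chi> k l. if l = i then axis j 1 $ k else A $ k $ l) / det A"
proof -
  have "A *v (matrix_inv A *v axis j 1) = axis j 1"
    using assms by (simp add: matrix_vector_mul_assoc matrix_inv_right)
  then have "matrix_inv A *v axis j 1 =
      (\<chi> i. det (\<chi> k l. if l = i then axis j 1 $ k else A $ k $ l) / det A)"
    using assms cramer[of A] by (simp add: invertible_det_nz)
  then have "(matrix_inv A *v axis j 1) $ i =
      det (\<chi> k l. if l = i then axis j 1 $ k else A $ k $ l) / det A"
    by simp
  moreover have "(matrix_inv A *v axis j 1) $ i = matrix_inv A $ i $ j"
    by (simp add: matrix_vector_mult_def axis_def if_distrib[of "(*) _"] cong: if_cong)
  ultimately show ?thesis
    by simp
qed

text \<open>Invertibility is the open condition that the continuous function \<open>det\<close> is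
  nonzero.\<close>

lemma eventually_invertible:
  fixes A :: "'b \<Rightarrow> 'a::real_normed_field^'n^'n"
  assumes "(A \<longlongrightarrow> L) F" and "invertible L"
  shows "\<forall>\<^sub>F x in F. invertible (A x)"
  using tendsto_imp_eventually_ne[OF tendsto_det[OF assms(1)], of 0] assms(2)
  by (simp add: invertible_det_nz)

lemma tendsto_matrix_inv:
  fixes A :: "'b \<Rightarrow> 'a::real_normed_field^'n^'n"
  assumes "(A \<longlongrightarrow> L) F" and "invertible L"
  shows "((\<lambda>x. matrix_inv (A x)) \<longlongrightarrow> matrix_inv L) F"
proof (intro vec_tendstoI)
  fix i j
  let ?N = "\<lambda>X :: 'a^'n^'n. (\<chi> k l. if l = i then axis j 1 $ k else X $ k $ l)"
  have "((\<lambda>x. ?N (A x)) \<longlongrightarrow> ?N L) F"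
    using assms(1) by (auto intro!: tendsto_vec_lambda tendsto_vec_nth)
  then have "((\<lambda>x. det (?N (A x)) / det (A x)) \<longlongrightarrow> det (?N L) / det L) F"
    using assms by (intro tendsto_divide tendsto_det) (auto simp: invertible_det_nz)
  \<comment> \<open>Cramer's formula describes \<open>matrix_inv (A x)\<close> only where
    \<open>A x\<close> is invertible, which is eventually the case.\<close>
  then show "((\<lambda>x. matrix_inv (A x) $ i $ j) \<longlongrightarrow> matrix_inv L $ i $ j) F"
    using eventually_invertible[OF assms] assms(2)
    by (auto simp: matrix_inv_nth elim!: Lim_transform_eventually eventually_mono)
qed

lemma has_vector_derivative_iff_tendsto:
  "(f has_vector_derivative f') (at x within S) \<longleftrightarrow>
    ((\<lambda>y. (f y - f x) /\<^sub>R (y - x)) \<longlongrightarrow> f') (at x within S)"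
proof -
  \<comment> \<open>Dividing by \<open>y - x\<close> or by its absolute value gives the same norm.
    The point \<open>y = x\<close>, where the equation can fail, is excluded by the punctured
    filter.\<close>
  have "(\<lambda>y. norm ((f y - f x - (y - x) *\<^sub>R f') /\<^sub>R norm (y - x))) y =
      (\<lambda>y. norm ((f y - f x) /\<^sub>R (y - x) - f')) y" if "y \<noteq> x" for y
  proof -
    have "(f y - f x) /\<^sub>R (y - x) - f' = (f y - f x - (y - x) *\<^sub>R f') /\<^sub>R (y - x)"
      using that by (simp add: scaleR_diff_right)
    then show ?thesis by simp
  qed
  then have "((\<lambda>y. norm ((f y - f x - (y - x) *\<^sub>R f') /\<^sub>R norm (y - x))) \<longlongrightarrow> 0) (at x within S) \<longleftrightarrow>
      ((\<lambda>y. norm ((f y - f x) /\<^sub>R (y - x) - f')) \<longlongrightarrow> 0) (at x within S)"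
    by (intro tendsto_cong) (auto simp: eventually_at_filter)
  then show ?thesis
    unfolding has_vector_derivative_def has_derivative_at_within
    by (simp only: tendsto_norm_zero_iff LIM_zero_iff bounded_linear_scaleR_left simp_thms)
qed

lemma has_vector_derivative_matrix_inv:
  fixes A :: "real \<Rightarrow> 'a::{real_normed_field,euclidean_space}^'n^'n"
  assumes A: "(A has_vector_derivative D) (at t within S)" and inv: "invertible (A t)"
  shows "((\<lambda>x. matrix_inv (A x)) has_vector_derivative
    - (matrix_inv (A t) ** D ** matrix_inv (A t))) (at t within S)"
proof -
  let ?F = "at t within S"
  have lim: "(A \<longlongrightarrow> A t) ?F"
    using has_vector_derivative_continuous[OF A] by (simp add: continuous_within)
  \<comment> \<open>In this factorisation the quotient tends to \<open>D\<close>, the left factor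
    converges by continuity of inversion, and the right one is constant.\<close>
  have "((\<lambda>y. - (matrix_inv (A y) ** ((A y - A t) /\<^sub>R (y - t)) ** matrix_inv (A t))) \<longlongrightarrow>
      - (matrix_inv (A t) ** D ** matrix_inv (A t))) ?F"
    using A unfolding has_vector_derivative_iff_tendsto
    by (intro tendsto_minus matrix_matrix_mult.tendsto tendsto_const
        tendsto_matrix_inv[OF lim inv])
  moreover have "\<forall>\<^sub>F y in ?F.
      - (matrix_inv (A y) ** ((A y - A t) /\<^sub>R (y - t)) ** matrix_inv (A t)) =
      (matrix_inv (A y) - matrix_inv (A t)) /\<^sub>R (y - t)"
    using eventually_invertible[OF lim inv]
  proof eventually_elim
    case (elim y)
    have "matrix_inv (A y) ** (A y - A t) ** matrix_inv (A t) =
        matrix_inv (A t) - matrix_inv (A y)"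
      using elim inv
      by (simp add: matrix_matrix_mult.diff_left matrix_matrix_mult.diff_right matrix_inv_left
          matrix_mul_assoc[symmetric] matrix_inv_right)
    then show ?case
      by (simp add: matrix_matrix_mult.scaleR_left matrix_matrix_mult.scaleR_right
          flip: scaleR_minus_right)
  qed
  ultimately show ?thesis
    unfolding has_vector_derivative_iff_tendsto by (rule Lim_transform_eventually)
qed

text \<open>The real inner product of complex numbers \<open>z\<close>, \<open>w\<close> is
  \<open>Re (cnj z * w)\<close>; summing rows before columns produces the diagonal of the
  product.\<close>

lemma inner_eq_Re_trace:
  fixes E F :: "complex^'n^'m"
  shows "E \<bullet> F = Re (trace (conj_transpose E ** F))"
proof -
  have "E \<bullet> F = (\<Sum>i\<in>UNIV. \<Sum>j\<in>UNIV. Re (cnj (E $ i $ j) * F $ i $ j))"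
    by (simp add: inner_vec_def inner_complex_def)
  also have "\<dots> = (\<Sum>j\<in>UNIV. \<Sum>i\<in>UNIV. Re (cnj (E $ i $ j) * F $ i $ j))"
    by (rule sum.swap)
  finally show ?thesis
    by (simp add: trace_def matrix_matrix_mult_def conj_transpose_def transpose_def)
qed

lemma cscale_matrix_mult_left: "cscale c A ** B = cscale c (A ** B)"
  by (simp add: cscale_def vec_eq_iff matrix_matrix_mult_def sum_distrib_left mult.assoc)

lemma trace_cscale: "trace (cscale c A) = c * trace A"
  by (simp add: cscale_def trace_def sum_distrib_left)

lemma has_vector_derivative_cscale:
  assumes "(f has_vector_derivative f') (at t within S)"
  shows "((\<lambda>x. cscale (f x) A) has_vector_derivative cscale f' A) (at t within S)"
proof -
  have "linear (\<lambda>z. cscale z A)"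
    by (intro linearI) (simp_all add: cscale_def vec_eq_iff algebra_simps)
  then show ?thesis
    by (intro bounded_linear.has_vector_derivative[OF _ assms]) (simp add: linear_conv_bounded_linear)
qed

lemma has_real_derivative_squared_residual:
  fixes A :: "real \<Rightarrow> complex^'r^'r" and B :: "complex^'m^'r" and C :: "complex^'r^'p"
  assumes A: "(A has_vector_derivative cscale c Q) (at t within S)" and inv: "invertible (A t)"
  shows "((\<lambda>x. (frobenius_norm (g - C ** matrix_inv (A x) ** B))\<^sup>2) has_real_derivative
    2 * Re (c * trace (Q ** matrix_inv (A t) ** B **
      conj_transpose (g - C ** matrix_inv (A t) ** B) ** C ** matrix_inv (A t)))) (at t within S)"
proof -
  let ?X = "matrix_inv (A t)" and ?D = "cscale c Q"
  let ?E = "\<lambda>x. g - C ** matrix_inv (A x) ** B"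
  let ?H = "conj_transpose (?E t)"
  \<comment> \<open>The minus sign from differentiating the inverse cancels the one in the
    residual.\<close>
  have E: "(?E has_vector_derivative C ** (?X ** ?D ** ?X) ** B) (at t within S)"
    using has_vector_derivative_diff[OF has_vector_derivative_const
        matrix_matrix_mult.has_vector_derivative[OF matrix_matrix_mult.has_vector_derivative[OF
            has_vector_derivative_const has_vector_derivative_matrix_inv[OF A inv]]
          has_vector_derivative_const]]
    by (simp add: matrix_matrix_mult.minus_left matrix_matrix_mult.minus_right
        matrix_matrix_mult.zero_left matrix_matrix_mult.zero_right)
  have "trace (?H ** (C ** (?X ** ?D ** ?X) ** B)) = trace ((?H ** C ** ?X) ** (?D ** ?X ** B))"
    by (simp add: matrix_mul_assoc)
  also have "\<dots> = trace ((?D ** ?X ** B) ** (?H ** C ** ?X))"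
    by (rule trace_mul_sym)
  also have "\<dots> = c * trace (Q ** ?X ** B ** ?H ** C ** ?X)"
    by (simp add: matrix_mul_assoc cscale_matrix_mult_left trace_cscale)
  finally have "?E t \<bullet> (C ** (?X ** ?D ** ?X) ** B) = Re (c * trace (Q ** ?X ** B ** ?H ** C ** ?X))"
    by (simp only: inner_eq_Re_trace)
  then show ?thesis
    \<comment> \<open>The product rule for \<open>?E x \<bullet> ?E x\<close> gives two terms, equal
      by symmetry: hence the factor 2.\<close>
    using bounded_bilinear.has_vector_derivative[OF bounded_bilinear_inner E E]
    by (simp add: has_real_derivative_iff_has_vector_derivative frobenius_norm_eq_norm
        power2_norm_eq_inner inner_commute)
qed

lemma has_vector_derivative_complex_of_real:
  "(complex_of_real has_vector_derivative 1) (at t within S)"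
  using bounded_linear.has_vector_derivative[OF bounded_linear_of_real has_vector_derivative_id]
  by simp

text \<open>Each damping parameter enters \<open>Phi_R\<close> or \<open>Phi_S\<close> through a
  single coefficient of this form, with \<open>b\<close> equal to \<open>s\<close> or
  \<open>\<i>\<close>.\<close>

lemma has_vector_derivative_cscale_affine:
  "((\<lambda>x. cscale (a + b * complex_of_real x) A) has_vector_derivative cscale b A) (at t within S)"
  using has_vector_derivative_cscale[OF has_vector_derivative_add[OF has_vector_derivative_const
        has_vector_derivative_mult_right[OF has_vector_derivative_complex_of_real]]]
  by simp

lemma has_vector_derivative_Phi_R_mass:
  "((\<lambda>a. Phi_R M K s a \<beta>) has_vector_derivative cscale s (cmat M)) (at \<alpha> within S)"
  unfolding Phi_R_def
  using has_vector_derivative_add[OF has_vector_derivative_cscale_affine has_vector_derivative_const]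
  by simp

lemma has_vector_derivative_Phi_R_stiffness:
  "((\<lambda>b. Phi_R M K s \<alpha> b) has_vector_derivative cscale s (cmat K)) (at \<beta> within S)"
  unfolding Phi_R_def
  using has_vector_derivative_add[OF has_vector_derivative_const has_vector_derivative_cscale_affine]
  by simp

lemma has_vector_derivative_Phi_S:
  "((\<lambda>e. Phi_S M K s e) has_vector_derivative cscale \<i> (cmat K)) (at \<eta> within S)"
  unfolding Phi_S_def
  using has_vector_derivative_add[OF has_vector_derivative_const has_vector_derivative_cscale_affine]
  by simp

theorem theorem5:
  fixes M K :: "real^'r^'r" and Bu :: "real^'m^'r" and Cp Cv :: "real^'r^'p"
    and s :: "nat \<Rightarrow> complex" and g :: "nat \<Rightarrow> complex^'m^'p" and k :: nat
    and \<alpha> \<beta> \<eta> :: real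
  assumes "\<alpha> \<ge> 0" and "\<beta> \<ge> 0" and "\<eta> \<ge> 0"
  shows "(invertible (Phi_R M K (s k) \<alpha> \<beta>) \<longrightarrow>
       ((\<lambda>a. J_R M K Bu Cp Cv (s k) (g k) a \<beta>) has_real_derivative
          2 * Re (s k * trace (cmat M ** matrix_inv (Phi_R M K (s k) \<alpha> \<beta>) ** cmat Bu **
            conj_transpose (g k - C_out Cp Cv (s k) ** matrix_inv (Phi_R M K (s k) \<alpha> \<beta>) ** cmat Bu) **
            C_out Cp Cv (s k) ** matrix_inv (Phi_R M K (s k) \<alpha> \<beta>))))
         (at \<alpha> within {0..}) \<and>
       ((\<lambda>b. J_R M K Bu Cp Cv (s k) (g k) \<alpha> b) has_real_derivative
          2 * Re (s k * trace (cmat K ** matrix_inv (Phi_R M K (s k) \<alpha> \<beta>) ** cmat Bu **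
            conj_transpose (g k - C_out Cp Cv (s k) ** matrix_inv (Phi_R M K (s k) \<alpha> \<beta>) ** cmat Bu) **
            C_out Cp Cv (s k) ** matrix_inv (Phi_R M K (s k) \<alpha> \<beta>))))
         (at \<beta> within {0..})) \<and>
     (invertible (Phi_S M K (s k) \<eta>) \<longrightarrow>
       ((\<lambda>e. J_S M K Bu Cp Cv (s k) (g k) e) has_real_derivative
          2 * Re (\<i> * trace (cmat K ** matrix_inv (Phi_S M K (s k) \<eta>) ** cmat Bu **
            conj_transpose (g k - C_out Cp Cv (s k) ** matrix_inv (Phi_S M K (s k) \<eta>) ** cmat Bu) **
            C_out Cp Cv (s k) ** matrix_inv (Phi_S M K (s k) \<eta>))))
         (at \<eta> within {0..}))"
  unfolding J_R_def J_S_def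
  \<comment> \<open>Here \<open>S\<close> is \<open>{0..}\<close>, so at parameter value 0 the
    derivative is the right-sided one.\<close>
  by (intro conjI impI has_real_derivative_squared_residual has_vector_derivative_Phi_R_mass
      has_vector_derivative_Phi_R_stiffness has_vector_derivative_Phi_S)

end
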